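(* For every integer $a\ge 0$, $\overline{T_a}=\mathbb{R}_{\ge 0}$ (closure in the Euclidean topology on $\mathbb{R}$). Moreover, $T_0=\mathbb{Q}_{>0}$.
   Context: Partitions are drawn as Young diagrams $\mathbb{D}(\lambda)$ in English notation; $c_{i,j}$ is the cell in row $i$, column $j$. The hook length $h_\lambda(c)$ is the number of cells of $\mathbb{D}(\lambda)$ weakly right of $c$ in its row or weakly below $c$ in its column (counting $c$ once). For $\mu\subseteq\lambda$, an excited diagram of $\lambda/\mu$ is a subset of $\mathbb{D}(\lambda)$ obtained from $\mathbb{D}(\mu)$ by repeatedly replacing a cell $c_{i,j}\in D$ by $c_{i+1,j+1}$, allowed iff $c_{i+1,j+1}\in\mathbb{D}(\lambda)$ and none of $c_{i,j+1},c_{i+1,j},c_{i+1,j+1}$ lies in $D$; $\mathbb{E}(\lambda/\mu)$ is their set. A ribbon with $n$ cells is read from its lower-left to its upper-right cell, each successive cell directly right of or directly above the previous; it corresponds to the set of $i\in\{1,\ldots,n-1\}$ with cell $i$ directly below cell $i+1$. A descent set is a non-empty finite set $I$ of positive integers; $\lambda^I$ is the unique partition with $\lambda^I_1=\lambda^I_2$ such that the cells $c_{i,j}\in\mathbb{D}(\lambda^I)$ with fewer than three of $c_{i,j+1},c_{i+1,j},c_{i+1,j+1}$ in $\mathbb{D}(\lambda^I)$ form a ribbon corresponding to $I$; this ribbon is $\mathbb{D}(\lambda^I)\setminus\mathbb{D}(\mu^I)$ for a partition $\mu^I$. Let $s(I)=\lambda^I_1-1$. Naruse-Newton coefficients: every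 excited diagram of $\lambda^I/\mu^I$ meets row 1 in $\{c_{1,1},\ldots,c_{1,r}\}$, $0\le r\le s$; for $0\le j\le s(I)$, $C_j(I)=\sum_D\prod_{c\in D,\,c\notin\text{row }1}h_{\lambda^I}(c)$, summed over $D\in\mathbb{E}(\lambda^I/\mu^I)$ with exactly $s-j$ cells in row 1. For an integer $a\ge0$, $T_a=\{C_{s-a-1}(I)/C_{s-a}(I)\mid I\text{ a descent set with } s=s(I)\ge a+1\}$. *)

theory Defs
  imports "HOL-Analysis.Analysis"
begin

type_synonym cell = "nat \<times> nat"   (* (row i, column j), both starting at 1 *)

definition is_partition :: "nat list \<Rightarrow> bool" where
  "is_partition lam \<longleftrightarrow> (\<forall>k < length lam. lam ! k > 0) \<and> sorted_wrt (\<ge>) lam"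

definition ydiag :: "nat list \<Rightarrow> cell set" where
  "ydiag lam = {(i, j). 1 \<le> i \<and> i \<le> length lam \<and> 1 \<le> j \<and> j \<le> lam ! (i - 1)}"

definition hook :: "nat list \<Rightarrow> cell \<Rightarrow> nat" where
  "hook lam c = card {(i', j') \<in> ydiag lam.
      (i' = fst c \<and> j' \<ge> snd c) \<or> (j' = snd c \<and> i' \<ge> fst c)}"

definition excited_move :: "nat list \<Rightarrow> cell set \<Rightarrow> cell set \<Rightarrow> bool" where
  "excited_move lam D D' \<longleftrightarrow> (\<exists>i j. (i, j) \<in> D \<and> (i + 1, j + 1) \<in> ydiag lam \<and>
      (i, j + 1) \<notin> D \<and> (i + 1, j) \<notin> D \<and> (i + 1, j + 1) \<notin> D \<and>
      D' = (D - {(i, j)}) \<union> {(i + 1, j + 1)})"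

definition excited :: "nat list \<Rightarrow> nat list \<Rightarrow> cell set set" where
  "excited lam mu = {D. (excited_move lam)\<^sup>*\<^sup>* (ydiag mu) D}"

text \<open>R is a ribbon (read from lower-left to upper-right) corresponding to the set I.\<close>
definition ribbon_corr :: "cell set \<Rightarrow> nat set \<Rightarrow> bool" where
  "ribbon_corr R I \<longleftrightarrow> (\<exists>n (c :: nat \<Rightarrow> cell). n \<ge> 1 \<and> inj_on c {1..n} \<and> R = c ` {1..n} \<and>
      (\<forall>k \<in> {1..<n}. c (Suc k) = (fst (c k), snd (c k) + 1) \<or>
                      c k = (fst (c (Suc k)) + 1, snd (c (Suc k)))) \<and>
      I = {k \<in> {1..<n}. c k = (fst (c (Suc k)) + 1, snd (c (Suc k)))})"

definition descent_set :: "nat set \<Rightarrow> bool" where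
  "descent_set I \<longleftrightarrow> finite I \<and> I \<noteq> {} \<and> (\<forall>i \<in> I. i \<ge> 1)"

definition outer_cells :: "nat list \<Rightarrow> cell set" where
  "outer_cells lam = {(i, j) \<in> ydiag lam.
      \<not> ((i, j + 1) \<in> ydiag lam \<and> (i + 1, j) \<in> ydiag lam \<and> (i + 1, j + 1) \<in> ydiag lam)}"

definition lamI :: "nat set \<Rightarrow> nat list" where
  "lamI I = (THE lam. is_partition lam \<and> length lam \<ge> 2 \<and> lam ! 0 = lam ! 1 \<and>
                     ribbon_corr (outer_cells lam) I)"

definition muI :: "nat set \<Rightarrow> nat list" where
  "muI I = (THE mu. is_partition mu \<and> ydiag (lamI I) - ydiag mu = outer_cells (lamI I))"

definition sI :: "nat set \<Rightarrow> nat" where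
  "sI I = lamI I ! 0 - 1"

definition NN_coeff :: "nat set \<Rightarrow> nat \<Rightarrow> nat" where
  "NN_coeff I j = (\<Sum>D \<in> {D \<in> excited (lamI I) (muI I). card {c \<in> D. fst c = 1} = sI I - j}.
      \<Prod>c \<in> {c \<in> D. fst c \<noteq> 1}. hook (lamI I) c)"

definition T_set :: "nat \<Rightarrow> real set" where
  "T_set a = {real (NN_coeff I (sI I - a - 1)) / real (NN_coeff I (sI I - a)) | I.
               descent_set I \<and> sI I \<ge> a + 1}"

end

theory Submission
  imports Defs
begin

text \<open>
  Since \<open>\<lambda>/\<mu>\<close> is the border strip of \<open>\<lambda>\<close>, in an excited diagram every cell of \<open>\<mu>\<close> has moved at most
  once, and the cells that have not moved form an arbitrary order ideal \<open>\<nu> \<subseteq> \<mu>\<close>. So \<open>C\<close> with index \<open>s - a\<close> is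
  a hook-weighted sum over the ideals \<open>\<nu>\<close> whose first row has \<open>a\<close> cells.

  For a rectangle with \<open>k + 1\<close> rows and \<open>b\<close> columns, removing the rows of \<open>\<nu>\<close> one at a time gives a
  recursion that is solved by binomial coefficients and factorials. The quotient of consecutive
  coefficients is \<open>(k + a) / ((a + 1) (b - a - 1))\<close>, and these values exhaust the positive rationals.
  Hence \<open>T\<^sub>a\<close> contains all positive rationals and is dense in the nonnegative reals.
  Conversely, \<open>T\<^sub>0\<close> consists of positive rationals because the ideals \<open>\<nu> = {}\<close> and \<open>\<nu> = {c\<^sub>1\<^sub>1}\<close>
  contribute positive terms to its denominators and numerators.
\<close>

subsection \<open>The partition of a descent set\<close>

text \<open>A form of \<open>ribbon_corr\<close> that exposes the parametrisation and prescribes the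
  direction of every step through \<open>I\<close>, so that a path can be followed or extended step
  by step.\<close>

definition ribbon_path :: "(nat \<Rightarrow> cell) \<Rightarrow> nat \<Rightarrow> nat set \<Rightarrow> cell set \<Rightarrow> bool" where
  "ribbon_path c n I R \<longleftrightarrow> n \<ge> 1 \<and> R = c ` {1..n} \<and> I \<subseteq> {1..<n} \<and>
     (\<forall>k \<in> {1..<n}. if k \<in> I then c k = (fst (c (Suc k)) + 1, snd (c (Suc k)))
                     else c (Suc k) = (fst (c k), snd (c k) + 1))"

lemma ribbon_path_up:
  assumes "ribbon_path c n I R" "1 \<le> k" "k < n" "k \<in> I"
  shows "fst (c k) = fst (c (Suc k)) + 1" "snd (c k) = snd (c (Suc k))"
  using assms unfolding ribbon_path_def by (auto dest!: bspec[of _ _ k])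

lemma ribbon_path_right:
  assumes "ribbon_path c n I R" "1 \<le> k" "k < n" "k \<notin> I"
  shows "fst (c (Suc k)) = fst (c k)" "snd (c (Suc k)) = snd (c k) + 1"
  using assms unfolding ribbon_path_def by (auto dest!: bspec[of _ _ k])

text \<open>Each step, up or right, raises the content (column minus row) by exactly one, so a
  content difference counts steps. Integers are used because contents can be negative.\<close>

lemma ribbon_path_mono:
  assumes "ribbon_path c n I R" "1 \<le> k" "k \<le> l" "l \<le> n"
  shows "fst (c l) \<le> fst (c k)" "snd (c k) \<le> snd (c l)"
    and "int (snd (c l)) - int (fst (c l)) = int (snd (c k)) - int (fst (c k)) + int (l - k)"
proof -
  have "l \<le> n \<longrightarrow> fst (c l) \<le> fst (c k) \<and> snd (c k) \<le> snd (c l) \<and>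
    int (snd (c l)) - int (fst (c l)) = int (snd (c k)) - int (fst (c k)) + int (l - k)"
    using \<open>k \<le> l\<close>
  proof (induction l rule: dec_induct)
    case (step l)
    then show ?case
      using ribbon_path_up[OF assms(1), of l] ribbon_path_right[OF assms(1), of l] \<open>1 \<le> k\<close>
      by (cases "l \<in> I") auto
  qed simp
  then show "fst (c l) \<le> fst (c k)" "snd (c k) \<le> snd (c l)"
    "int (snd (c l)) - int (fst (c l)) = int (snd (c k)) - int (fst (c k)) + int (l - k)"
    using \<open>l \<le> n\<close> by auto
qed

lemma ribbon_path_inj:
  assumes "ribbon_path c n I R"
  shows "inj_on c {1..n}"
proof (rule linorder_inj_onI)
  fix k l :: nat
  assume "k < l" "k \<in> {1..n}" "l \<in> {1..n}"
  then show "c k \<noteq> c l"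
    using ribbon_path_mono(3)[OF assms, of k l] by auto
qed auto

text \<open>An up step keeps the column and a right step raises it, so the two directions exclude
  each other and \<open>I\<close> can be read off from the cells.\<close>

lemma ribbon_corr_iff_ribbon_path:
  "ribbon_corr R I \<longleftrightarrow> (\<exists>n c. ribbon_path c n I R)"
proof
  assume "ribbon_corr R I"
  then obtain n c where "n \<ge> 1" "R = c ` {1..n}"
    "\<forall>k \<in> {1..<n}. c (Suc k) = (fst (c k), snd (c k) + 1) \<or>
                      c k = (fst (c (Suc k)) + 1, snd (c (Suc k)))"
    "I = {k \<in> {1..<n}. c k = (fst (c (Suc k)) + 1, snd (c (Suc k)))}"
    unfolding ribbon_corr_def by blast
  then have "ribbon_path c n I R"
    unfolding ribbon_path_def by auto
  then show "\<exists>n c. ribbon_path c n I R" by blast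
next
  assume "\<exists>n c. ribbon_path c n I R"
  then obtain n c where c: "ribbon_path c n I R" by blast
  have "k \<in> I \<longleftrightarrow> c k = (fst (c (Suc k)) + 1, snd (c (Suc k)))" if "k \<in> {1..<n}" for k
    using that ribbon_path_up[OF c, of k] ribbon_path_right(2)[OF c, of k]
    by (cases "k \<in> I") (auto simp: prod_eq_iff)
  then have "I = {k \<in> {1..<n}. c k = (fst (c (Suc k)) + 1, snd (c (Suc k)))}"
    using c unfolding ribbon_path_def by blast
  moreover have "\<forall>k \<in> {1..<n}. c (Suc k) = (fst (c k), snd (c k) + 1) \<or>
                      c k = (fst (c (Suc k)) + 1, snd (c (Suc k)))"
    using c unfolding ribbon_path_def by meson
  moreover have "n \<ge> 1" "R = c ` {1..n}"
    using c unfolding ribbon_path_def by auto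
  ultimately show "ribbon_corr R I"
    unfolding ribbon_corr_def using ribbon_path_inj[OF c]
    by (intro exI[of _ n] exI[of _ c] conjI)
qed

lemma is_partition_antimono:
  assumes "is_partition lam" "i \<le> j" "j < length lam"
  shows "lam ! j \<le> lam ! i"
  using assms unfolding is_partition_def sorted_wrt_iff_nth_less
  by (cases "i = j") auto

lemma ydiag_bounds:
  assumes "is_partition lam" "(i, j) \<in> ydiag lam"
  shows "1 \<le> i" "i \<le> length lam" "1 \<le> j" "j \<le> lam ! 0"
  using assms is_partition_antimono[of lam 0 "i - 1"] unfolding ydiag_def by force+

lemma row_end_in_outer_cells:
  assumes "is_partition lam" "i < length lam"
  shows "(Suc i, lam ! i) \<in> outer_cells lam"
  using assms unfolding outer_cells_def ydiag_def is_partition_def by (auto simp: Suc_le_eq)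

lemma bottom_in_outer_cells:
  assumes "is_partition lam" "lam \<noteq> []"
  shows "(length lam, 1) \<in> outer_cells lam"
  using assms unfolding outer_cells_def ydiag_def is_partition_def
  by (auto simp: Suc_le_eq)

lemma outer_cells_subset: "outer_cells lam \<subseteq> ydiag lam"
  unfolding outer_cells_def by auto

text \<open>The lower-left and upper-right corners of the diagram are outer cells, and monotonicity
  along the path forces them to be its ends. As rows 1 and 2 have equal length, the end of row 2 is
  an outer cell too, which makes the last step an up step and fixes \<open>n\<close> through
  \<open>I\<close>.\<close>

lemma ribbon_path_outer_cells_ends:
  assumes lam: "is_partition lam" "length lam \<ge> 2" "lam ! 0 = lam ! 1"
    and c: "ribbon_path c n I (outer_cells lam)"
  shows "c 1 = (length lam, 1)" "c n = (1, lam ! 0)" "n = Suc (Max I)"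
proof -
  have R: "outer_cells lam = c ` {1..n}" and "n \<ge> 1"
    using c by (auto simp: ribbon_path_def)
  have bnd: "1 \<le> fst (c k) \<and> fst (c k) \<le> length lam \<and> 1 \<le> snd (c k) \<and> snd (c k) \<le> lam ! 0"
    if "k \<in> {1..n}" for k
  proof -
    have "c k \<in> ydiag lam" using outer_cells_subset[of lam] R that by blast
    then show ?thesis
      using ydiag_bounds[OF lam(1), of "fst (c k)" "snd (c k)"] by simp
  qed
  have "(length lam, 1) \<in> c ` {1..n}"
    using bottom_in_outer_cells[of lam] lam R by force
  then obtain k where k: "k \<in> {1..n}" "c k = (length lam, 1)" by auto
  show "c 1 = (length lam, 1)"
    using ribbon_path_mono[OF c, of 1 k] k bnd[of 1] by (auto simp: prod_eq_iff)
  have "(1, lam ! 0) \<in> c ` {1..n}"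
    using row_end_in_outer_cells[of lam 0] lam R by force
  then obtain l where l: "l \<in> {1..n}" "c l = (1, lam ! 0)" by auto
  show cn: "c n = (1, lam ! 0)"
    using ribbon_path_mono[OF c, of l n] l bnd[of n] by (auto simp: prod_eq_iff)
  have "(2, lam ! 0) \<in> c ` {1..n}"
    using row_end_in_outer_cells[of lam 1] lam R by (force simp: numeral_2_eq_2)
  then obtain p where p: "p \<in> {1..n}" "c p = (2, lam ! 0)" by auto
  have "p \<noteq> n" using p cn by auto
  then have "p \<le> n - 1" "p < n" using p by auto
  \<comment> \<open>A right step into the last cell would place \<open>c (n - 1)\<close> strictly
    left of the earlier cell \<open>c p\<close>.\<close>
  have "n - 1 \<in> I"
  proof (rule ccontr)
    assume "n - 1 \<notin> I"
    with ribbon_path_right[OF c, of "n - 1"] ribbon_path_mono(2)[OF c, of p "n - 1"] p cn \<open>p \<le> n - 1\<close>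
    show False by auto
  qed
  moreover have "I \<subseteq> {1..<n}" using c by (simp add: ribbon_path_def)
  ultimately have "Max I = n - 1"
    by (intro Max_eqI) (force dest: finite_subset)+
  then show "n = Suc (Max I)" using \<open>n \<ge> 1\<close> by simp
qed

text \<open>The column of a ribbon cell is determined by \<open>I\<close> counting from the first cell, where it is 1,
  and its row counting from the last cell, where it is 1.\<close>

lemma lamI_unique:
  assumes lam: "is_partition lam" "length lam \<ge> 2" "lam ! 0 = lam ! 1"
      "ribbon_corr (outer_cells lam) I"
    and lam': "is_partition lam'" "length lam' \<ge> 2" "lam' ! 0 = lam' ! 1"
      "ribbon_corr (outer_cells lam') I"
  shows "lam = lam'"
proof -
  obtain c n where c: "ribbon_path c n I (outer_cells lam)"
    using lam(4) ribbon_corr_iff_ribbon_path by blast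
  obtain c' n' where c': "ribbon_path c' n' I (outer_cells lam')"
    using lam'(4) ribbon_corr_iff_ribbon_path by blast
  note e = ribbon_path_outer_cells_ends[OF lam(1-3) c]
    and e' = ribbon_path_outer_cells_ends[OF lam'(1-3) c']
  have n: "n' = n" using e(3) e'(3) by simp
  have "n \<ge> 1" using c by (simp add: ribbon_path_def)
  have row: "fst (c k) = fst (c' k)" if "1 \<le> k" "k \<le> n" for k
    using that(2)
  proof (induction k rule: inc_induct)
    case base
    then show ?case using e e' n by simp
  next
    case (step k)
    have "1 \<le> k" using step that by simp
    then show ?case
      using ribbon_path_up(1)[OF c, of k] ribbon_path_right(1)[OF c, of k]
        ribbon_path_up(1)[OF c', of k] ribbon_path_right(1)[OF c', of k] step.IH step.hyps n
      by linarith
  qed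
  have col: "snd (c k) = snd (c' k)" if "1 \<le> k" "k \<le> n" for k
    using that
  proof (induction k rule: dec_induct)
    case base
    then show ?case using e e' n by simp
  next
    case (step k)
    have "snd (c k) = snd (c' k)" "1 \<le> k" "k < n" using step by auto
    then show ?case
      using ribbon_path_up(2)[OF c, of k] ribbon_path_right(2)[OF c, of k]
        ribbon_path_up(2)[OF c', of k] ribbon_path_right(2)[OF c', of k] n by linarith
  qed
  have "c ` {1..n} = c' ` {1..n}"
    using row col by (intro image_cong) (auto simp: prod_eq_iff)
  then have R: "outer_cells lam = outer_cells lam'"
    using c c' n by (simp add: ribbon_path_def)
  have len: "length lam = length lam'"
    using row[of 1] \<open>n \<ge> 1\<close> e e' by simp
  show ?thesis
  proof (rule nth_equalityI[OF len])
    fix i assume i: "i < length lam"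
    \<comment> \<open>Every row ends in an outer cell, so equal ribbons bound the row lengths by
      each other in both directions.\<close>
    have "(Suc i, lam ! i) \<in> ydiag lam'" "(Suc i, lam' ! i) \<in> ydiag lam"
      using row_end_in_outer_cells[OF lam(1) i] row_end_in_outer_cells[OF lam'(1), of i] i len R
        outer_cells_subset by auto
    then show "lam ! i = lam' ! i"
      unfolding ydiag_def by auto
  qed
qed

lemma lamI_eqI:
  assumes "is_partition lam" "length lam \<ge> 2" "lam ! 0 = lam ! 1" "ribbon_corr (outer_cells lam) I"
  shows "lamI I = lam"
  unfolding lamI_def using assms lamI_unique by (intro the_equality) auto

section \<open>Existence of the partition, by growing the ribbon\<close>

lemma ydiag_Cons:
  "(i, j) \<in> ydiag (x # xs) \<longleftrightarrow> i = 1 \<and> 1 \<le> j \<and> j \<le> x \<or> (\<exists>i'. i = Suc i' \<and> (i', j) \<in> ydiag xs)"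
proof (cases i)
  case (Suc i')
  then show ?thesis unfolding ydiag_def by (cases i') auto
qed (simp add: ydiag_def)

lemma ydiag_downward_closed:
  assumes "is_partition lam" "(i, j) \<in> ydiag lam" "1 \<le> i'" "i' \<le> i" "1 \<le> j'" "j' \<le> j"
  shows "(i', j') \<in> ydiag lam"
  using assms is_partition_antimono[of lam "i' - 1" "i - 1"] unfolding ydiag_def by force

text \<open>This realises a right step. No old cell changes its status: row 2 has at most
  \<open>x\<close> cells, so \<open>(1, x)\<close> stays outer because \<open>(2, x + 1)\<close> is
  missing.\<close>

lemma outer_cells_extend_row:
  assumes "is_partition (x # xs)"
  shows "outer_cells (Suc x # xs) = insert (1, Suc x) (outer_cells (x # xs))"
proof -
  have le: "j \<le> x" if "(Suc 0, j) \<in> ydiag xs" for j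
    using ydiag_bounds(4)[OF assms, of 2 j] that by (simp add: ydiag_Cons numeral_2_eq_2)
  have 0: "(0, j) \<notin> ydiag xs" for j by (simp add: ydiag_def)
  show ?thesis
    unfolding outer_cells_def by (auto simp: ydiag_Cons 0 dest: le)
qed

text \<open>This realises an up step. The old ribbon moves down by one row, and in the new top row
  only the last cell lacks a neighbour.\<close>

lemma outer_cells_repeat_row:
  assumes "is_partition (x # xs)"
  shows "outer_cells (x # x # xs) =
    insert (1, x) ((\<lambda>c. (Suc (fst c), snd c)) ` outer_cells (x # xs))"
proof -
  have x: "1 \<le> x" using assms by (auto simp: is_partition_def)
  have 0: "(0, j) \<notin> ydiag l" for j l by (simp add: ydiag_def)
  have "(i, j) \<in> outer_cells (x # x # xs) \<longleftrightarrow>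
    (i, j) = (1, x) \<or> (\<exists>i'. i = Suc i' \<and> (i', j) \<in> outer_cells (x # xs))" for i j
    unfolding outer_cells_def using x
    by (cases i) (auto simp: ydiag_Cons[of _ _ x "x # xs"] 0 ydiag_Cons[of "Suc 0" _ x xs])
  then show ?thesis
    by (auto simp: image_iff) force+
qed

lemma ribbon_path_snoc_up:
  assumes c: "ribbon_path c n I R" and x: "c n = (fst x + 1, snd x)"
  shows "ribbon_path (c(Suc n := x)) (Suc n) (insert n I) (insert x R)"
proof -
  have R: "(c(Suc n := x)) ` {1..Suc n} = insert x (c ` {1..n})"
    by (force simp: atLeastAtMostSuc_conv)
  have "k \<in> {1..<Suc n} \<Longrightarrow> k = n \<or> k \<in> {1..<n}" for k by auto
  then show ?thesis
    using assms unfolding ribbon_path_def R by fastforce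
qed

lemma ribbon_path_snoc_right:
  assumes c: "ribbon_path c n I R" and x: "x = (fst (c n), snd (c n) + 1)"
  shows "ribbon_path (c(Suc n := x)) (Suc n) I (insert x R)"
proof -
  have R: "(c(Suc n := x)) ` {1..Suc n} = insert x (c ` {1..n})"
    by (force simp: atLeastAtMostSuc_conv)
  have "n \<notin> I" "n \<ge> 1" "I \<subseteq> {1..<Suc n}" "R = c ` {1..n}"
    using c by (auto simp: ribbon_path_def)
  moreover have "if k \<in> I then (c(Suc n := x)) k =
      (fst ((c(Suc n := x)) (Suc k)) + 1, snd ((c(Suc n := x)) (Suc k)))
    else (c(Suc n := x)) (Suc k) = (fst ((c(Suc n := x)) k), snd ((c(Suc n := x)) k) + 1)"
    if "k \<in> {1..<Suc n}" for k
  proof (cases "k = n")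
    case True
    then show ?thesis using x \<open>n \<notin> I\<close> by simp
  next
    case False
    then show ?thesis using c that by (simp add: ribbon_path_def)
  qed
  ultimately show ?thesis
    unfolding ribbon_path_def R by (simp del: fun_upd_apply)
qed

lemma ribbon_path_shift_down:
  assumes c: "ribbon_path c n I R"
  shows "ribbon_path (\<lambda>k. (Suc (fst (c k)), snd (c k))) n I ((\<lambda>c. (Suc (fst c), snd c)) ` R)"
  using assms unfolding ribbon_path_def
  by (auto simp: image_image prod_eq_iff split: if_splits)

text \<open>For each index in turn the top row is repeated if the index lies in \<open>I\<close> and
  lengthened otherwise. The invariant that the path stops at the end of row 1 says where the next
  cell is attached.\<close>

lemma ribbon_path_exists:
  "\<exists>x xs c. is_partition (x # xs) \<and>
     ribbon_path c (Suc n) (I \<inter> {1..n}) (outer_cells (x # xs)) \<and> c (Suc n) = (1, x)"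
proof (induction n)
  case 0
  have "ribbon_path (\<lambda>_. (1, 1)) (Suc 0) (I \<inter> {1..0}) (outer_cells [1])"
    unfolding ribbon_path_def outer_cells_def ydiag_def by auto
  moreover have "is_partition [1]"
    by (simp add: is_partition_def)
  ultimately show ?case by blast
next
  case (Suc n)
  then obtain x xs c where lam: "is_partition (x # xs)"
    and c: "ribbon_path c (Suc n) (I \<inter> {1..n}) (outer_cells (x # xs))" "c (Suc n) = (1, x)"
    by blast
  show ?case
  proof (cases "Suc n \<in> I")
    case True
    have I: "I \<inter> {1..Suc n} = insert (Suc n) (I \<inter> {1..n})"
      using True by (auto simp: le_Suc_eq)
    have "is_partition (x # x # xs)"
      using lam unfolding is_partition_def by (auto simp: less_Suc_eq_0_disj)
    moreover have "ribbon_path ((\<lambda>k. (Suc (fst (c k)), snd (c k)))(Suc (Suc n) := (1, x)))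
        (Suc (Suc n)) (I \<inter> {1..Suc n}) (outer_cells (x # x # xs))"
      unfolding I outer_cells_repeat_row[OF lam]
      by (rule ribbon_path_snoc_up[OF ribbon_path_shift_down[OF c(1)]]) (simp add: c(2))
    moreover have "((\<lambda>k. (Suc (fst (c k)), snd (c k)))(Suc (Suc n) := (1, x))) (Suc (Suc n)) = (1, x)"
      by simp
    ultimately show ?thesis by blast
  next
    case False
    have I: "I \<inter> {1..Suc n} = I \<inter> {1..n}"
      using False by (auto simp: le_Suc_eq)
    have "is_partition (Suc x # xs)"
      using lam unfolding is_partition_def by (auto simp: less_Suc_eq_0_disj)
    moreover have "ribbon_path (c(Suc (Suc n) := (1, Suc x)))
        (Suc (Suc n)) (I \<inter> {1..Suc n}) (outer_cells (Suc x # xs))"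
      unfolding I outer_cells_extend_row[OF lam]
      by (rule ribbon_path_snoc_right[OF c(1)]) (simp add: c(2))
    moreover have "(c(Suc (Suc n) := (1, Suc x))) (Suc (Suc n)) = (1, Suc x)"
      by simp
    ultimately show ?thesis by blast
  qed
qed

lemma lamI_exists:
  assumes "descent_set I"
  shows "\<exists>lam. is_partition lam \<and> length lam \<ge> 2 \<and> lam ! 0 = lam ! 1 \<and>
                     ribbon_corr (outer_cells lam) I"
proof -
  \<comment> \<open>The step at \<open>Max I\<close> is performed separately: being an up step, it
    repeats the top row and so makes the first two rows equal.\<close>
  define n where "n = Max I - 1"
  have "Max I \<in> I" "\<And>i. i \<in> I \<Longrightarrow> 1 \<le> i \<and> i \<le> Max I"
    using assms by (auto simp: descent_set_def)
  then have I: "I = insert (Suc n) (I \<inter> {1..n})"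
    unfolding n_def by force
  obtain x xs c where lam: "is_partition (x # xs)"
    and c: "ribbon_path c (Suc n) (I \<inter> {1..n}) (outer_cells (x # xs))" "c (Suc n) = (1, x)"
    using ribbon_path_exists by blast
  have "is_partition (x # x # xs)"
    using lam unfolding is_partition_def by (auto simp: less_Suc_eq_0_disj)
  moreover have "ribbon_path ((\<lambda>k. (Suc (fst (c k)), snd (c k)))(Suc (Suc n) := (1, x)))
      (Suc (Suc n)) (insert (Suc n) (I \<inter> {1..n})) (outer_cells (x # x # xs))"
    unfolding outer_cells_repeat_row[OF lam]
    by (rule ribbon_path_snoc_up[OF ribbon_path_shift_down[OF c(1)]]) (simp add: c(2))
  then have "ribbon_corr (outer_cells (x # x # xs)) I"
    using I ribbon_corr_iff_ribbon_path by metis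
  ultimately show ?thesis
    by (intro exI[of _ "x # x # xs"]) auto
qed

subsection \<open>Excited diagrams of a border strip\<close>

text \<open>The complement of the border strip, that is, the diagram of \<open>muI\<close>. A cell
  whose diagonal successor lies in the diagram has its right and lower neighbours there as
  well.\<close>

definition inner_cells :: "nat list \<Rightarrow> cell set" where
  "inner_cells lam = {(i, j). 1 \<le> i \<and> 1 \<le> j \<and> (Suc i, Suc j) \<in> ydiag lam}"

lemma inner_cells_subset:
  assumes "is_partition lam"
  shows "inner_cells lam \<subseteq> ydiag lam"
  using ydiag_downward_closed[OF assms] unfolding inner_cells_def by force

lemma ydiag_diff_inner_cells:
  assumes "is_partition lam"
  shows "ydiag lam - inner_cells lam = outer_cells lam"
proof -
  have "(i, j) \<in> outer_cells lam \<longleftrightarrow> (i, j) \<in> ydiag lam \<and> (i, j) \<notin> inner_cells lam" for i j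
    using ydiag_downward_closed[OF assms, of "Suc i" "Suc j" i "Suc j"]
      ydiag_downward_closed[OF assms, of "Suc i" "Suc j" "Suc i" j] ydiag_bounds[OF assms, of i j]
    unfolding inner_cells_def outer_cells_def by auto
  then show ?thesis by auto
qed

lemma finite_ydiag: "finite (ydiag lam)"
proof (rule finite_subset)
  show "ydiag lam \<subseteq> (SIGMA i : {1..length lam}. {1..lam ! (i - 1)})"
    unfolding ydiag_def by auto
qed auto

text \<open>Up to a diagonal shift the inner cells are \<open>lam\<close> without its first row and
  first column. The rows that become empty form a tail, which \<open>takeWhile\<close> cuts
  off.\<close>

lemma inner_cells_is_ydiag:
  assumes lam: "is_partition lam"
  shows "\<exists>mu. is_partition mu \<and> ydiag mu = inner_cells lam"
proof -
  define t where "t = takeWhile (\<lambda>x. x > 1) (tl lam)"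
  define mu where "mu = map (\<lambda>x. x - 1) t"
  have t_le: "length t \<le> length lam - 1"
    unfolding t_def using length_takeWhile_le[of "\<lambda>x. x > 1" "tl lam"] by simp
  have t_nth: "t ! i = lam ! Suc i" "t ! i > 1" if "i < length t" for i
  proof -
    show "t ! i > 1"
      using nth_mem[OF that] set_takeWhileD[of "t ! i" "\<lambda>x. x > 1" "tl lam"] unfolding t_def by blast
    show "t ! i = lam ! Suc i"
      using takeWhile_nth[of i "\<lambda>x. x > 1" "tl lam"] that t_le by (simp add: t_def nth_tl)
  qed
  have "is_partition mu"
    using t_nth t_le is_partition_antimono[OF lam]
    unfolding is_partition_def sorted_wrt_iff_nth_less mu_def by (auto intro!: diff_le_mono)
  moreover have "(i, j) \<in> ydiag mu \<longleftrightarrow> (i, j) \<in> inner_cells lam" for i j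
  proof
    assume "(i, j) \<in> ydiag mu"
    then have *: "1 \<le> i" "1 \<le> j" "i - 1 < length t" "j \<le> t ! (i - 1) - 1"
      unfolding ydiag_def mu_def by auto
    then show "(i, j) \<in> inner_cells lam"
      using t_nth[of "i - 1"] t_le unfolding inner_cells_def ydiag_def by auto
  next
    assume "(i, j) \<in> inner_cells lam"
    then have *: "1 \<le> i" "1 \<le> j" "Suc i \<le> length lam" "Suc j \<le> lam ! i"
      unfolding inner_cells_def ydiag_def by auto
    have i: "i \<le> length t"
    proof (rule ccontr)
      assume "\<not> i \<le> length t"
      then have "length t < length (tl lam)" "Suc (length t) \<le> i" using * by auto
      then have "\<not> lam ! Suc (length t) > 1"
        using nth_length_takeWhile[of "\<lambda>x. x > 1" "tl lam"] by (simp add: t_def nth_tl)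
      then show False
        using is_partition_antimono[OF lam \<open>Suc (length t) \<le> i\<close>] * by simp
    qed
    then show "(i, j) \<in> ydiag mu"
      using * t_nth[of "i - 1"] unfolding ydiag_def mu_def by auto
  qed
  ultimately show ?thesis by (intro exI[of _ mu]) auto
qed

lemma ydiag_inj:
  assumes "is_partition mu" "is_partition mu'" "ydiag mu = ydiag mu'"
  shows "mu = mu'"
proof (rule nth_equalityI)
  have *: "i < length nu \<longleftrightarrow> (Suc i, 1) \<in> ydiag nu" if "is_partition nu" for i nu
    using that unfolding ydiag_def is_partition_def by (auto simp: Suc_le_eq)
  then have **: "i < length mu \<longleftrightarrow> i < length mu'" for i
    using assms by simp
  then show "length mu = length mu'"
    by (metis linorder_neqE_nat less_irrefl)
  fix i assume i: "i < length mu"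
  have "(Suc i, mu ! i) \<in> ydiag mu'" "(Suc i, mu' ! i) \<in> ydiag mu"
    using row_end_in_outer_cells[OF assms(1), of i] row_end_in_outer_cells[OF assms(2), of i] i **
      outer_cells_subset assms(3) by auto
  then show "mu ! i = mu' ! i"
    unfolding ydiag_def by auto
qed

text \<open>The definition of \<^const>\<open>muI\<close> does not ask for \<open>ydiag mu \<subseteq> ydiag lam\<close>; this is
  automatic, since every row and the first column of \<open>lam\<close> end in an outer cell.\<close>

lemma ydiag_eq_inner_cellsI:
  assumes lam: "is_partition lam" "lam \<noteq> []" and mu: "is_partition mu"
    and diff: "ydiag lam - ydiag mu = outer_cells lam"
  shows "ydiag mu = inner_cells lam"
proof -
  have "ydiag mu \<subseteq> ydiag lam"
  proof (rule ccontr)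
    assume "\<not> ydiag mu \<subseteq> ydiag lam"
    then obtain i j where ij: "(i, j) \<in> ydiag mu" "(i, j) \<notin> ydiag lam" by auto
    then have "1 \<le> i" "1 \<le> j" using ydiag_bounds[OF mu] by auto
    show False
    proof (cases "i \<le> length lam")
      case True
      then have end_outer: "(i, lam ! (i - 1)) \<in> outer_cells lam"
        using row_end_in_outer_cells[OF lam(1), of "i - 1"] \<open>1 \<le> i\<close> by simp
      then have "1 \<le> lam ! (i - 1)" "lam ! (i - 1) \<le> j"
        using ij \<open>1 \<le> i\<close> \<open>1 \<le> j\<close> True outer_cells_subset[of lam] unfolding ydiag_def by auto
      then have "(i, lam ! (i - 1)) \<in> ydiag mu"
        using ydiag_downward_closed[OF mu ij(1)] \<open>1 \<le> i\<close> by simp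
      then show False using end_outer diff by blast
    next
      case False
      then have "(length lam, 1) \<in> ydiag mu"
        using ydiag_downward_closed[OF mu ij(1), of "length lam" 1] \<open>1 \<le> j\<close> lam(2)
        by (simp add: Suc_le_eq)
      then show False using bottom_in_outer_cells[OF lam] diff by blast
    qed
  qed
  then show ?thesis
    using diff ydiag_diff_inner_cells[OF lam(1)] inner_cells_subset[OF lam(1)] by blast
qed

lemma ydiag_muI:
  assumes lam: "is_partition (lamI I)" "lamI I \<noteq> []"
  shows "ydiag (muI I) = inner_cells (lamI I)"
proof -
  let ?P = "\<lambda>mu. is_partition mu \<and> ydiag (lamI I) - ydiag mu = outer_cells (lamI I)"
  obtain mu where "is_partition mu" "ydiag mu = inner_cells (lamI I)"
    using inner_cells_is_ydiag[OF lam(1)] by blast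
  then have "?P mu" using ydiag_diff_inner_cells[OF lam(1)] by simp
  moreover have "mu' = mu" if "?P mu'" for mu'
    using that \<open>?P mu\<close> ydiag_eq_inner_cellsI[OF lam, of mu] ydiag_eq_inner_cellsI[OF lam, of mu']
    by (intro ydiag_inj) simp_all
  ultimately have "?P (muI I)"
    unfolding muI_def by (rule theI)
  then show ?thesis using ydiag_eq_inner_cellsI[OF lam] by blast
qed

section \<open>Excited diagrams as order ideals of unmoved cells\<close>

definition cell_ideal :: "cell set \<Rightarrow> bool" where
  "cell_ideal N \<longleftrightarrow> (\<forall>i j i' j'. (i, j) \<in> N \<longrightarrow> 1 \<le> i' \<longrightarrow> i' \<le> i \<longrightarrow> 1 \<le> j' \<longrightarrow> j' \<le> j \<longrightarrow> (i', j') \<in> N)"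

lemma cell_idealD:
  "cell_ideal N \<Longrightarrow> (i, j) \<in> N \<Longrightarrow> 1 \<le> i' \<Longrightarrow> i' \<le> i \<Longrightarrow> 1 \<le> j' \<Longrightarrow> j' \<le> j \<Longrightarrow> (i', j') \<in> N"
  unfolding cell_ideal_def by blast

text \<open>The excited diagram in which exactly the cells of \<open>M - N\<close> have moved, each of them once.\<close>

definition excite :: "cell set \<Rightarrow> cell set \<Rightarrow> cell set" where
  "excite M N = N \<union> (\<lambda>(i, j). (Suc i, Suc j)) ` (M - N)"

lemma in_excite:
  "(i, j) \<in> excite M N \<longleftrightarrow>
     (i, j) \<in> N \<or> (\<exists>i' j'. i = Suc i' \<and> j = Suc j' \<and> (i', j') \<in> M \<and> (i', j') \<notin> N)"
  unfolding excite_def by auto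

lemma inner_cells_ideal:
  assumes "is_partition lam"
  shows "cell_ideal (inner_cells lam)"
  unfolding cell_ideal_def inner_cells_def using ydiag_downward_closed[OF assms] by auto

text \<open>By the last assumption the diagonal predecessor of \<open>(i, j)\<close> has not moved
  if it lies in \<open>M\<close>. Hence no moved cell covers \<open>(i, j)\<close>, and the place
  really becomes vacant.\<close>

lemma excite_remove_corner:
  assumes M: "N \<subseteq> M" and ij: "(i, j) \<in> N" "(Suc i, Suc j) \<notin> N"
    and disj: "\<And>i' j'. i = Suc i' \<Longrightarrow> j = Suc j' \<Longrightarrow> (i', j') \<in> M \<Longrightarrow> (i', j') \<in> N"
  shows "excite M (N - {(i, j)}) = excite M N - {(i, j)} \<union> {(i + 1, j + 1)}"
proof -
  have "(p, q) \<in> excite M (N - {(i, j)}) \<longleftrightarrow> (p, q) \<in> excite M N - {(i, j)} \<union> {(i + 1, j + 1)}" for p q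
    unfolding in_excite Un_iff Diff_iff using assms by (auto simp: in_excite)
  then show ?thesis by auto
qed

lemma excited_move_excite:
  assumes M: "M = inner_cells lam"
    and N: "cell_ideal N" "N \<subseteq> M"
    and move: "excited_move lam (excite M N) D'"
  shows "\<exists>N'. cell_ideal N' \<and> N' \<subseteq> M \<and> D' = excite M N'"
proof -
  obtain i j where ij: "(i, j) \<in> excite M N" "(Suc i, Suc j) \<in> ydiag lam"
    "(i, Suc j) \<notin> excite M N" "(Suc i, j) \<notin> excite M N" "(Suc i, Suc j) \<notin> excite M N"
    "D' = excite M N - {(i, j)} \<union> {(i + 1, j + 1)}"
    using move unfolding excited_move_def by auto
  have pos: "1 \<le> p \<and> 1 \<le> q" if "(p, q) \<in> M" for p q
    using that M unfolding inner_cells_def by auto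
  have "1 \<le> i \<and> 1 \<le> j"
    using ij(1) N(2) pos unfolding in_excite by auto
  then have ijM: "(i, j) \<in> M"
    using ij(2) M unfolding inner_cells_def by auto
  \<comment> \<open>An inner cell outside \<open>N\<close> has moved, so its diagonal successor is
    occupied, which the move forbids. Thus only unmoved cells can move.\<close>
  have ijN: "(i, j) \<in> N"
    using ij(5) ijM unfolding in_excite by auto
  \<comment> \<open>The moving cell is a corner of \<open>N\<close>: any further cell of
    \<open>N\<close> beyond it would put its right or lower neighbour into \<open>N\<close> and
    block the move.\<close>
  have "cell_ideal (N - {(i, j)})"
    unfolding cell_ideal_def
  proof (intro allI impI)
    fix p q p' q'
    assume pq: "(p, q) \<in> N - {(i, j)}" "1 \<le> p'" "p' \<le> p" "1 \<le> q'" "q' \<le> q"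
    have "(p', q') \<noteq> (i, j)"
    proof
      assume e: "(p', q') = (i, j)"
      then have "Suc i \<le> p \<or> Suc j \<le> q" using pq by auto
      then have "(Suc i, j) \<in> N \<or> (i, Suc j) \<in> N"
        using cell_idealD[OF N(1), of p q "Suc i" j] cell_idealD[OF N(1), of p q i "Suc j"] pq e by auto
      then show False using ij(3,4) unfolding in_excite by auto
    qed
    then show "(p', q') \<in> N - {(i, j)}"
      using cell_idealD[OF N(1), of p q p' q'] pq by auto
  qed
  moreover have "D' = excite M (N - {(i, j)})"
    unfolding ij(6)
  proof (rule excite_remove_corner[symmetric, OF N(2) ijN])
    show "(Suc i, Suc j) \<notin> N" using ij(5) unfolding in_excite by auto
    show "(i', j') \<in> N" if "i = Suc i'" "j = Suc j'" "(i', j') \<in> M" for i' j'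
      using cell_idealD[OF N(1) ijN, of i' j'] pos[OF that(3)] that by auto
  qed
  ultimately show ?thesis using N(2) by blast
qed

lemma excite_excited_move:
  assumes M: "M = inner_cells lam"
    and N: "cell_ideal N" "cell_ideal (insert (i, j) N)" "insert (i, j) N \<subseteq> M" "(i, j) \<notin> N"
  shows "excited_move lam (excite M (insert (i, j) N)) (excite M N)"
proof -
  let ?N = "insert (i, j) N"
  have pos: "1 \<le> p \<and> 1 \<le> q" if "(p, q) \<in> M" for p q
    using that M unfolding inner_cells_def by auto
  have ij: "(i, j) \<in> M" "1 \<le> i" "1 \<le> j" using N(3) pos by auto
  have n1: "(Suc i, j) \<notin> N" "(i, Suc j) \<notin> N" "(Suc i, Suc j) \<notin> N"
    using cell_idealD[OF N(1), of "Suc i" j i j] cell_idealD[OF N(1), of i "Suc j" i j]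
      cell_idealD[OF N(1), of "Suc i" "Suc j" i j] N(4) ij by auto
  have prev: "(p, q) \<in> ?N" if "(p, q) \<in> M" "p \<le> i" "q \<le> j" for p q
    using cell_idealD[OF N(2), of i j p q] pos[OF that(1)] that by auto
  have "excite M N = excite M (?N - {(i, j)})" using N(4) by simp
  also have "\<dots> = excite M ?N - {(i, j)} \<union> {(i + 1, j + 1)}"
  proof (rule excite_remove_corner)
    show "(i', j') \<in> ?N" if "i = Suc i'" "j = Suc j'" "(i', j') \<in> M" for i' j'
      using prev[OF that(3)] that by simp
  qed (use N(3) n1 in auto)
  finally have eq: "excite M N = excite M ?N - {(i, j)} \<union> {(i + 1, j + 1)}" .
  \<comment> \<open>None of the three cells is the target of a moved cell either, since their
    diagonal predecessors are at most \<open>(i, j)\<close> in both coordinates and by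
    \<open>prev\<close> have not moved.\<close>
  have "(i, j + 1) \<notin> excite M ?N" "(i + 1, j) \<notin> excite M ?N" "(i + 1, j + 1) \<notin> excite M ?N"
    using n1 unfolding in_excite by (auto dest: prev)
  moreover have "(i + 1, j + 1) \<in> ydiag lam" using ij M unfolding inner_cells_def by auto
  moreover have "(i, j) \<in> excite M ?N" unfolding in_excite by auto
  ultimately show ?thesis
    unfolding excited_move_def using eq by blast
qed

text \<open>Induction on the number of moved cells. Returning a moved cell with minimal coordinate
  sum to \<open>N\<close> gives an ideal again, since all smaller cells of \<open>M\<close> have
  smaller sum and lie in \<open>N\<close>; exciting that cell is then the last move.\<close>

lemma excite_reachable:
  assumes lam: "is_partition lam" and M: "M = inner_cells lam"
    and N: "cell_ideal N" "N \<subseteq> M"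
  shows "(excited_move lam)\<^sup>*\<^sup>* M (excite M N)"
  using N
proof (induction "card (M - N)" arbitrary: N rule: less_induct)
  case less
  have fin: "finite M" using M inner_cells_subset[OF lam] finite_ydiag finite_subset by blast
  show ?case
  proof (cases "N = M")
    case True
    then show ?thesis by (simp add: excite_def)
  next
    case False
    then obtain c where c: "c \<in> M - N" and
      min: "\<And>d. d \<in> M - N \<Longrightarrow> fst c + snd c \<le> fst d + snd d"
      using less.prems arg_min_nat_lemma[of "\<lambda>c. c \<in> M - N" _ "\<lambda>d. fst d + snd d"] by blast
    obtain i j where ij: "c = (i, j)" by (cases c)
    have "cell_ideal (insert (i, j) N)"
      unfolding cell_ideal_def
    proof (intro allI impI)
      fix p q p' q'
      assume pq: "(p, q) \<in> insert (i, j) N" "1 \<le> p'" "p' \<le> p" "1 \<le> q'" "q' \<le> q"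
      show "(p', q') \<in> insert (i, j) N"
      proof (cases "(p, q) \<in> N")
        case True
        then show ?thesis using cell_idealD[OF less.prems(1) True] pq by auto
      next
        case False
        then have e: "p = i" "q = j" using pq by auto
        have "(p', q') \<in> M"
          using cell_idealD[OF inner_cells_ideal[OF lam], of i j p' q'] M c ij pq e by auto
        then show ?thesis using min[of "(p', q')"] ij pq e by auto
      qed
    qed
    moreover have sub: "insert (i, j) N \<subseteq> M" using less.prems c ij by auto
    moreover have "card (M - insert (i, j) N) < card (M - N)"
      using fin c ij by (intro psubset_card_mono) auto
    ultimately have "(excited_move lam)\<^sup>*\<^sup>* M (excite M (insert (i, j) N))"
      using less.hyps by blast
    moreover have "excited_move lam (excite M (insert (i, j) N)) (excite M N)"
      using excite_excited_move[OF M less.prems(1) \<open>cell_ideal (insert (i, j) N)\<close> sub] c ij by auto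
    ultimately show ?thesis by (rule rtranclp.rtrancl_into_rtrancl)
  qed
qed

lemma excited_eq:
  assumes lam: "is_partition lam" and mu: "ydiag mu = inner_cells lam"
  shows "excited lam mu = excite (inner_cells lam) ` {N. cell_ideal N \<and> N \<subseteq> inner_cells lam}"
proof -
  have "\<exists>N. cell_ideal N \<and> N \<subseteq> inner_cells lam \<and> D = excite (inner_cells lam) N"
    if "(excited_move lam)\<^sup>*\<^sup>* (inner_cells lam) D" for D
    using that
  proof (induction rule: rtranclp_induct)
    case base
    show ?case
      by (rule exI[of _ "inner_cells lam"]) (simp add: excite_def inner_cells_ideal[OF lam])
  next
    case (step D D')
    then show ?case using excited_move_excite[OF refl] by blast
  qed
  then show ?thesis
    using excite_reachable[OF lam refl] unfolding excited_def mu by blast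
qed

text \<open>The ideal is recovered row by row. A cell of row \<open>i + 1\<close> in only one ideal
  would have to be the target of a moved cell for the other; its diagonal predecessor, however, lies
  in the first ideal and so, by induction, in both.\<close>

lemma excite_inj:
  assumes N: "cell_ideal N" "N \<subseteq> M" and N': "cell_ideal N'" "N' \<subseteq> M"
    and pos: "\<And>p q. (p, q) \<in> M \<Longrightarrow> 1 \<le> p \<and> 1 \<le> q"
    and eq: "excite M N = excite M N'"
  shows "N = N'"
proof -
  have "\<forall>j. (i, j) \<in> N \<longleftrightarrow> (i, j) \<in> N'" for i
  proof (induction i)
    case 0
    then show ?case using pos N N' by fastforce
  next
    case (Suc i)
    have *: "(Suc i, j) \<in> B"
      if A: "(Suc i, j) \<in> A" "cell_ideal A" "A \<subseteq> M" and B: "B \<subseteq> M" "excite M A = excite M B"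
        and IH: "\<And>j. (i, j) \<in> A \<longleftrightarrow> (i, j) \<in> B" for A B j
    proof (rule ccontr)
      assume "(Suc i, j) \<notin> B"
      moreover have "(Suc i, j) \<in> excite M B" using A(1) B(2) in_excite by blast
      ultimately obtain j' where j': "j = Suc j'" "(i, j') \<in> M" "(i, j') \<notin> B"
        unfolding in_excite by auto
      then have "(i, j') \<in> A" using cell_idealD[OF A(2,1), of i j'] pos by auto
      then show False using IH j' by blast
    qed
    show ?case using *[of _ N N'] *[of _ N' N] N N' eq Suc by metis
  qed
  then show ?thesis by auto
qed

lemma excite_row_1:
  assumes "\<And>p q. (p, q) \<in> M \<Longrightarrow> 1 \<le> p \<and> 1 \<le> q"
  shows "{c \<in> excite M N. fst c = 1} = {c \<in> N. fst c = 1}"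
  using assms unfolding excite_def by fastforce

lemma NN_coeff_eq_sum_ideals:
  assumes lam: "is_partition (lamI I)" "lamI I \<noteq> []" and "r \<le> sI I"
  defines "M \<equiv> inner_cells (lamI I)"
  shows "NN_coeff I (sI I - r) =
    (\<Sum>N | cell_ideal N \<and> N \<subseteq> M \<and> card {c \<in> N. fst c = 1} = r.
      \<Prod>c \<in> {c \<in> excite M N. fst c \<noteq> 1}. hook (lamI I) c)"
proof -
  have pos: "1 \<le> p \<and> 1 \<le> q" if "(p, q) \<in> M" for p q
    using that unfolding M_def inner_cells_def by auto
  \<comment> \<open>\<open>NN_coeff\<close> at index \<open>j\<close> asks for
    \<open>sI I - j\<close> cells in row 1; the bound on \<open>r\<close> makes the truncated
    subtraction exact.\<close>
  have "sI I - (sI I - r) = r" using \<open>r \<le> sI I\<close> by simp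
  moreover have "card {c \<in> excite M N. fst c = 1} = card {c \<in> N. fst c = 1}" for N
    using excite_row_1[of M N] pos by simp
  then have "{D \<in> excited (lamI I) (muI I). card {c \<in> D. fst c = 1} = r} =
     excite M ` {N. cell_ideal N \<and> N \<subseteq> M \<and> card {c \<in> N. fst c = 1} = r}"
    unfolding excited_eq[OF lam(1) ydiag_muI[OF lam]] M_def[symmetric]
    by auto
  moreover have "inj_on (excite M) {N. cell_ideal N \<and> N \<subseteq> M \<and> card {c \<in> N. fst c = 1} = r}"
    using excite_inj[OF _ _ _ _ pos] by (intro inj_onI) blast
  ultimately show ?thesis
    unfolding NN_coeff_def by (simp add: sum.reindex)
qed

subsection \<open>Weighted sums over the order ideals of a rectangle\<close>

text \<open>Equivalently, partitions with at most \<open>m\<close> parts, all of size at most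
  \<open>a\<close>.\<close>

definition ideals :: "nat \<Rightarrow> nat \<Rightarrow> cell set set" where
  "ideals m a = {N. cell_ideal N \<and> N \<subseteq> {1..m} \<times> {1..a}}"

definition add_row :: "nat \<Rightarrow> cell set \<Rightarrow> cell set" where
  "add_row r N = {1} \<times> {1..r} \<union> (\<lambda>(i, j). (Suc i, j)) ` N"

lemma in_add_row:
  "(i, j) \<in> add_row r N \<longleftrightarrow> i = 1 \<and> 1 \<le> j \<and> j \<le> r \<or> (\<exists>i'. i = Suc i' \<and> (i', j) \<in> N)"
  unfolding add_row_def by auto

lemma ideals_0: "ideals 0 a = {{}}"
  unfolding ideals_def cell_ideal_def by auto

lemma finite_ideals: "finite (ideals m a)"
  unfolding ideals_def by (rule finite_subset[of _ "Pow ({1..m} \<times> {1..a})"]) auto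

lemma add_row_in_ideals:
  assumes N: "N \<in> ideals m r" and "r \<le> a"
  shows "add_row r N \<in> ideals (Suc m) a"
proof -
  have N': "cell_ideal N" "N \<subseteq> {1..m} \<times> {1..r}" using N by (auto simp: ideals_def)
  have "cell_ideal (add_row r N)"
    unfolding cell_ideal_def
  proof (intro allI impI)
    fix i j i' j'
    assume ij: "(i, j) \<in> add_row r N" "1 \<le> i'" "i' \<le> i" "1 \<le> j'" "j' \<le> j"
    have "j \<le> r" using ij(1) N' unfolding in_add_row by auto
    show "(i', j') \<in> add_row r N"
    proof (cases "i' = 1")
      case True
      then show ?thesis using ij \<open>j \<le> r\<close> unfolding in_add_row by auto
    next
      case False
      then obtain p where p: "i' = Suc p" "1 \<le> p" using ij by (cases i') auto
      then obtain q where q: "i = Suc q" "(q, j) \<in> N" using ij False unfolding in_add_row by auto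
      then show ?thesis
        using cell_idealD[OF N'(1), of q j p j'] p ij unfolding in_add_row by auto
    qed
  qed
  moreover have "add_row r N \<subseteq> {1..Suc m} \<times> {1..a}"
    using N'(2) \<open>r \<le> a\<close> unfolding add_row_def by force
  ultimately show ?thesis by (simp add: ideals_def)
qed

lemma card_row_1_add_row:
  assumes "N \<in> ideals m r"
  shows "card {c \<in> add_row r N. fst c = 1} = r"
proof -
  have "(0, j) \<notin> N" for j using assms by (auto simp: ideals_def)
  then have "{c \<in> add_row r N. fst c = 1} = {1} \<times> {1..r}"
    unfolding add_row_def by auto
  then show ?thesis by (simp add: card_cartesian_product)
qed

lemma inj_on_add_row: "inj_on (add_row r) (ideals m r)"
proof (rule inj_onI)
  fix N N' assume *: "N \<in> ideals m r" "N' \<in> ideals m r" "add_row r N = add_row r N'"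
  have "(i, j) \<in> A \<longleftrightarrow> i \<ge> 1 \<and> (Suc i, j) \<in> add_row r A" if "A \<in> ideals m r" for A i j
    using that unfolding in_add_row ideals_def by auto
  then have "(i, j) \<in> N \<longleftrightarrow> (i, j) \<in> N'" for i j using * by metis
  then show "N = N'" by auto
qed

lemma downward_closed_eq_atLeastAtMost:
  fixes S :: "nat set"
  assumes "finite S" "\<And>x. x \<in> S \<Longrightarrow> 1 \<le> x" "\<And>x y. x \<in> S \<Longrightarrow> 1 \<le> y \<Longrightarrow> y \<le> x \<Longrightarrow> y \<in> S"
  shows "S = {1..card S}"
proof (cases "S = {}")
  case False
  define x where "x = Max S"
  have "x \<in> S" unfolding x_def using assms(1) False by simp
  have "y \<in> S \<longleftrightarrow> 1 \<le> y \<and> y \<le> x" for y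
    using assms(2)[of y] assms(3)[OF \<open>x \<in> S\<close>, of y] Max_ge[OF assms(1), of y]
    unfolding x_def by blast
  then have S: "S = {1..x}" by (intro set_eqI) simp
  have "card S = x" unfolding S by simp
  then show ?thesis using S by simp
qed simp

text \<open>With each cell an ideal contains the top cell of its column, so the first row bounds all
  others and the remaining rows form an ideal with only \<open>r\<close> columns.\<close>

lemma ideal_eq_add_row:
  assumes N: "N \<in> ideals (Suc m) a" and r: "card {c \<in> N. fst c = 1} = r"
  shows "N \<in> add_row r ` ideals m r" "r \<le> a"
proof -
  have N': "cell_ideal N" "N \<subseteq> {1..Suc m} \<times> {1..a}" using N by (auto simp: ideals_def)
  define S where "S = {j. (1, j) \<in> N}"
  have S: "S \<subseteq> {1..a}" using N'(2) unfolding S_def by auto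
  have "{c \<in> N. fst c = 1} = Pair 1 ` S" unfolding S_def by force
  then have card: "card S = r" using r by (simp add: card_image inj_on_def)
  then show "r \<le> a" using card_mono[OF _ S] by simp
  have "S = {1..r}"
    unfolding card[symmetric]
  proof (rule downward_closed_eq_atLeastAtMost)
    show "finite S" using S finite_subset by blast
    show "1 \<le> x" if "x \<in> S" for x using S that by auto
    show "y \<in> S" if "x \<in> S" "1 \<le> y" "y \<le> x" for x y
      using cell_idealD[OF N'(1), of 1 x 1 y] that unfolding S_def by auto
  qed
  then have row1: "(1, j) \<in> N \<longleftrightarrow> 1 \<le> j \<and> j \<le> r" for j
    unfolding S_def by (metis atLeastAtMost_iff mem_Collect_eq)
  define L where "L = {(i, j). 1 \<le> i \<and> (Suc i, j) \<in> N}"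
  have "j \<le> r" if "(i, j) \<in> N" for i j
    using cell_idealD[OF N'(1) that, of 1 j] N'(2) that row1[of j] by auto
  then have "L \<subseteq> {1..m} \<times> {1..r}"
    using N'(2) unfolding L_def by auto
  moreover have "cell_ideal L"
    using cell_idealD[OF N'(1)] unfolding cell_ideal_def L_def by auto
  moreover have "N = add_row r L"
  proof -
    have "(i, j) \<in> N \<longleftrightarrow> (i, j) \<in> add_row r L" for i j
    proof (cases "i = 1")
      case True
      then show ?thesis using row1[of j] unfolding in_add_row L_def by auto
    next
      case False
      have "i \<noteq> 0" if "(i, j) \<in> N" using that N'(2) by auto
      then show ?thesis using False unfolding in_add_row L_def by (cases i) auto
    qed
    then show ?thesis by auto
  qed
  ultimately show "N \<in> add_row r ` ideals m r"
    by (auto simp: ideals_def)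
qed

lemma ideals_with_row_1:
  assumes "r \<le> a"
  shows "{N \<in> ideals (Suc m) a. card {c \<in> N. fst c = 1} = r} = add_row r ` ideals m r"
  using ideal_eq_add_row(1) add_row_in_ideals[OF _ assms] card_row_1_add_row by blast

lemma sum_ideals_Suc:
  "(\<Sum>N\<in>ideals (Suc m) a. F N) = (\<Sum>r\<le>a. \<Sum>N\<in>ideals m r. F (add_row r N))"
proof -
  have "(\<Sum>N\<in>ideals (Suc m) a. F N) =
    (\<Sum>r\<le>a. \<Sum>N\<in>{N \<in> ideals (Suc m) a. card {c \<in> N. fst c = 1} = r}. F N)"
    using ideal_eq_add_row(2) by (intro sum.group[symmetric] finite_ideals) auto
  also have "\<dots> = (\<Sum>r\<le>a. \<Sum>N\<in>ideals m r. F (add_row r N))"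
  proof (rule sum.cong[OF refl])
    fix r assume "r \<in> {..a}"
    then have "r \<le> a" by simp
    show "(\<Sum>N\<in>{N \<in> ideals (Suc m) a. card {c \<in> N. fst c = 1} = r}. F N) =
      (\<Sum>N\<in>ideals m r. F (add_row r N))"
      unfolding ideals_with_row_1[OF \<open>r \<le> a\<close>] by (simp add: sum.reindex inj_on_add_row)
  qed
  finally show ?thesis .
qed

text \<open>In the rectangle with \<open>m + 2\<close> rows and \<open>B + 1\<close> columns the cell in row \<open>i + 1\<close> and column \<open>j\<close>
  has hook length \<open>m + B + 3 - i - j\<close>, and its diagonal successor has \<open>m + B + 1 - i - j\<close>. Row 1
  carries different weights and is split off; below, \<open>i\<close> counts the rows from row 2 on.\<close>

definition row_weight :: "nat \<Rightarrow> nat \<Rightarrow> nat \<Rightarrow> real" where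
  "row_weight B m r = (\<Prod>j=1..B. if j \<le> r then real (m + B + 3 - j) else real (m + B + 1 - j))"

definition ideal_weight :: "nat \<Rightarrow> nat \<Rightarrow> cell set \<Rightarrow> real" where
  "ideal_weight B m N = (\<Prod>i=1..m. \<Prod>j=1..B.
     if (i, j) \<in> N then real (m + B + 3 - i - j) else real (m + B + 1 - i - j))"

text \<open>The weights depend on \<open>m\<close> and \<open>i\<close> only through
  \<open>m - i\<close>, so the rows below the new one keep the weights they had for
  \<open>m\<close>.\<close>

lemma ideal_weight_add_row:
  assumes "N \<in> ideals m r"
  shows "ideal_weight B (Suc m) (add_row r N) = row_weight B m r * ideal_weight B m N"
proof -
  have 0: "(0, j) \<notin> N" for j using assms by (auto simp: ideals_def)
  have "ideal_weight B (Suc m) (add_row r N) =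
    (\<Prod>i=0..m. \<Prod>j=1..B. if (Suc i, j) \<in> add_row r N
       then real (m + B + 3 - i - j) else real (m + B + 1 - i - j))"
    unfolding ideal_weight_def One_nat_def prod.atLeast_Suc_atMost_Suc_shift comp_def
    by (intro prod.cong refl) simp
  also have "\<dots> = row_weight B m r * ideal_weight B m N"
    unfolding row_weight_def ideal_weight_def prod.atLeast_Suc_atMost[OF le0]
    by (intro arg_cong2[where f = "(*)"] prod.cong) (auto simp: in_add_row 0)
  finally show ?thesis .
qed

definition ideals_sum :: "nat \<Rightarrow> nat \<Rightarrow> nat \<Rightarrow> real" where
  "ideals_sum B m a = (\<Sum>N\<in>ideals m a. ideal_weight B m N)"

lemma ideals_sum_Suc:
  "ideals_sum B (Suc m) a = (\<Sum>r\<le>a. row_weight B m r * ideals_sum B m r)"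
  unfolding ideals_sum_def sum_ideals_Suc
  by (simp add: ideal_weight_add_row sum_distrib_left cong: sum.cong)

section \<open>Solving the recursion for the weighted sums\<close>

lemma row_weight_pos: "row_weight B m r > 0"
  unfolding row_weight_def by (intro prod_pos) auto

text \<open>Only the factor at \<open>j = r + 1\<close> changes, from \<open>m + B - r\<close> to
  \<open>m + B + 2 - r\<close>.\<close>

lemma row_weight_Suc:
  assumes "Suc r \<le> B"
  shows "row_weight B m (Suc r) * (real (m + B) - r) = row_weight B m r * (real (m + B) + 2 - r)"
proof -
  have ins: "{1..B} = insert (Suc r) ({1..B} - {Suc r})" using assms by auto
  define P where "P = (\<Prod>j\<in>{1..B} - {Suc r}. if j \<le> r then real (m + B + 3 - j) else real (m + B + 1 - j))"
  have "row_weight B m r = real (m + B + 1 - Suc r) * P"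
    unfolding row_weight_def P_def by (subst ins, subst prod.insert) auto
  moreover have "row_weight B m (Suc r) = real (m + B + 3 - Suc r) * P"
  proof -
    have "P = (\<Prod>j\<in>{1..B} - {Suc r}. if j \<le> Suc r then real (m + B + 3 - j) else real (m + B + 1 - j))"
      unfolding P_def by (intro prod.cong) auto
    then show ?thesis
      unfolding row_weight_def by (subst ins, subst prod.insert) auto
  qed
  moreover have "real (m + B + 1 - Suc r) = real (m + B) - r" "real (m + B + 3 - Suc r) = real (m + B) + 2 - r"
    using assms by (auto simp: of_nat_diff)
  ultimately show ?thesis by simp
qed

text \<open>The product of the successive quotients telescopes with step two, leaving two factors
  above and two below.\<close>

lemma row_weight_closed_form:
  assumes "r \<le> B"
  shows "row_weight B m r = row_weight B m 0 * ((real (m + B) + 2) * (real (m + B) + 1)) /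
     ((real (m + B) + 2 - r) * (real (m + B) + 1 - r))"
  using assms
proof (induction r)
  case (Suc r)
  have "row_weight B m (Suc r) = row_weight B m r * (real (m + B) + 2 - r) / (real (m + B) - r)"
    using row_weight_Suc[OF Suc.prems, of m] Suc.prems by (simp add: field_simps)
  also have "\<dots> = row_weight B m 0 * ((real (m + B) + 2) * (real (m + B) + 1)) /
     ((real (m + B) + 2 - real (Suc r)) * (real (m + B) + 1 - real (Suc r)))"
  proof -
    define x where "x = real (m + B) - real r"
    have x: "x > 0" using Suc.prems unfolding x_def by simp
    have e: "real (m + B) + 2 - real r = x + 2" "real (m + B) + 1 - real r = x + 1"
      "real (m + B) + 2 - real (Suc r) = x + 1" "real (m + B) + 1 - real (Suc r) = x"
      "real (m + B) - real r = x"
      unfolding x_def by auto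
    show ?thesis
      using Suc.IH Suc.prems x unfolding e by simp
  qed
  finally show ?case .
qed simp

text \<open>The dependence of \<open>ideals_sum B m a\<close> on \<open>a\<close>, up to a factor
  independent of \<open>a\<close>. The binomial coefficient is the number of ideals of an
  \<open>m\<close> by \<open>a\<close> rectangle.\<close>

definition ideals_profile :: "nat \<Rightarrow> nat \<Rightarrow> nat \<Rightarrow> real" where
  "ideals_profile B m a = real ((m + a) choose a) * fact (B - a) / fact (m + B - a)"

lemma sum_ideals_profile:
  assumes "a \<le> B"
  shows "(\<Sum>r\<le>a. ideals_profile B m r / ((real (m + B) + 2 - r) * (real (m + B) + 1 - r))) =
    ideals_profile B (Suc m) a / (real (m + B) + 2)"
  using assms
proof (induction a)
  case 0
  show ?case by (simp add: ideals_profile_def field_simps)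
next
  case (Suc a)
  \<comment> \<open>Writing \<open>B\<close> as a sum removes the truncated subtractions.\<close>
  then obtain d where B: "B = Suc a + d" using le_Suc_ex by blast
  define x y where "x = real ((m + Suc a) choose Suc a)" and "y = real ((m + Suc a) choose a)"
  define u v where "u = (fact d :: real)" and "v = (fact (m + d) :: real)"
  have xy: "x * (a + 1) = y * (m + 1)"
  proof -
    have "Suc a * ((m + Suc a) choose Suc a) = (m + Suc a - a) * ((m + Suc a) choose a)"
      unfolding binomial_absorb_comp binomial_absorption ..
    then have "real (Suc a * ((m + Suc a) choose Suc a)) = real ((m + Suc a - a) * ((m + Suc a) choose a))"
      by simp
    then show ?thesis
      unfolding x_def y_def of_nat_mult by (simp add: algebra_simps)
  qed
  have v: "v > 0" unfolding v_def by simp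
  have 1: "ideals_profile B m (Suc a) = x * u / v"
    unfolding ideals_profile_def x_def u_def v_def B by simp
  have 2: "ideals_profile B (Suc m) a =
      y * ((real d + 1) * u) / ((real m + real d + 2) * ((real m + real d + 1) * v))"
    unfolding ideals_profile_def y_def u_def v_def B by (simp add: Suc_diff_le add_ac)
  \<comment> \<open>Pascal's rule turns the binomial coefficient into \<open>x + y\<close>.\<close>
  have 3: "ideals_profile B (Suc m) (Suc a) = (x + y) * u / ((real m + real d + 1) * v)"
    unfolding ideals_profile_def x_def y_def u_def v_def B by (simp add: add_ac)
  have e: "real (m + B) + 2 - real (Suc a) = real m + real d + 2"
    "real (m + B) + 1 - real (Suc a) = real m + real d + 1"
    "real (m + B) + 2 = real m + real a + real d + 3"
    unfolding B by auto
  have p: "real m + real d + 2 \<noteq> 0" "real m + real d + 1 \<noteq> 0" "real m + real a + real d + 3 \<noteq> 0"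
    by linarith+
  have "(\<Sum>r\<le>Suc a. ideals_profile B m r / ((real (m + B) + 2 - r) * (real (m + B) + 1 - r))) =
    ideals_profile B (Suc m) a / (real (m + B) + 2) +
    ideals_profile B m (Suc a) / ((real (m + B) + 2 - real (Suc a)) * (real (m + B) + 1 - real (Suc a)))"
    using Suc by simp
  also have "\<dots> = u * (y * (real d + 1) + x * (real m + real a + real d + 3)) /
      ((real m + real a + real d + 3) * (real m + real d + 2) * (real m + real d + 1) * v)"
    unfolding e 1 2 using p v by (simp add: divide_simps del: mult_eq_0_iff) (simp add: algebra_simps)
  \<comment> \<open>The difference of the two sides is a relation between neighbouring binomial
    coefficients, namely \<open>xy\<close>; the factor \<open>m + d + 2\<close> then
    cancels.\<close>
  also have "y * (real d + 1) + x * (real m + real a + real d + 3) = (x + y) * (real m + real d + 2)"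
    using xy by (simp add: algebra_simps)
  also have "u * ((x + y) * (real m + real d + 2)) /
      ((real m + real a + real d + 3) * (real m + real d + 2) * (real m + real d + 1) * v) =
    ideals_profile B (Suc m) (Suc a) / (real (m + B) + 2)"
    unfolding e 3 using p by (simp add: mult_ac)
  finally show ?case .
qed

text \<open>The part of \<open>row_weight\<close> that depends on \<open>r\<close> is exactly the
  denominator summed in \<open>sum_ideals_profile\<close>; everything else goes into the constant,
  which cancels in quotients over \<open>a\<close>.\<close>

lemma ideals_sum_closed_form:
  "\<exists>K > 0. \<forall>a \<le> B. ideals_sum B m a = K * ideals_profile B m a"
proof (induction m)
  case 0
  show ?case
    by (rule exI[of _ 1]) (simp add: ideals_sum_def ideals_0 ideal_weight_def ideals_profile_def)
next
  case (Suc m)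
  then obtain K where K: "K > 0" "\<And>a. a \<le> B \<Longrightarrow> ideals_sum B m a = K * ideals_profile B m a" by blast
  define k where "k = row_weight B m 0 * ((real (m + B) + 2) * (real (m + B) + 1))"
  have "k > 0" unfolding k_def using row_weight_pos[of B m 0] by (intro mult_pos_pos) auto
  have "ideals_sum B (Suc m) a = (k * K / (real (m + B) + 2)) * ideals_profile B (Suc m) a" if "a \<le> B" for a
  proof -
    have "ideals_sum B (Suc m) a =
      (\<Sum>r\<le>a. (k * K) * (ideals_profile B m r / ((real (m + B) + 2 - r) * (real (m + B) + 1 - r))))"
      unfolding ideals_sum_Suc
    proof (rule sum.cong[OF refl])
      fix r assume "r \<in> {..a}"
      then have "r \<le> B" using that by simp
      show "row_weight B m r * ideals_sum B m r =
          (k * K) * (ideals_profile B m r / ((real (m + B) + 2 - r) * (real (m + B) + 1 - r)))"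
        unfolding row_weight_closed_form[OF \<open>r \<le> B\<close>, of m, folded k_def] K(2)[OF \<open>r \<le> B\<close>]
        by (simp only: times_divide_eq_left times_divide_eq_right mult.assoc)
    qed
    also have "\<dots> = (k * K / (real (m + B) + 2)) * ideals_profile B (Suc m) a"
      unfolding sum_distrib_left[symmetric] sum_ideals_profile[OF that] by simp
    finally show ?thesis .
  qed
  moreover have "k * K / (real (m + B) + 2) > 0" using K \<open>k > 0\<close> by simp
  ultimately show ?case by blast
qed

lemma ideals_sum_ratio:
  assumes "Suc a \<le> B"
  shows "ideals_sum B m a > 0"
    "ideals_sum B m (Suc a) / ideals_sum B m a =
      real (m + Suc a) * real (m + B - a) / (real (Suc a) * real (B - a))"
proof -
  obtain d where B: "B = Suc a + d" using assms le_Suc_ex by blast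
  obtain K where K: "K > 0" "\<And>a. a \<le> B \<Longrightarrow> ideals_sum B m a = K * ideals_profile B m a"
    using ideals_sum_closed_form by blast
  define x y where "x = real ((m + Suc a) choose Suc a)" and "y = real ((m + a) choose a)"
  define u v where "u = (fact d :: real)" and "v = (fact (m + d) :: real)"
  have pos: "u > 0" "v > 0" "y > 0" unfolding u_def v_def y_def by auto
  have "real (Suc (m + a) * ((m + a) choose a)) = real ((Suc (m + a) choose Suc a) * Suc a)"
    unfolding Suc_times_binomial_eq ..
  then have x: "x = real (m + Suc a) * y / real (Suc a)"
    unfolding x_def y_def of_nat_mult by (simp add: field_simps)
  have 1: "ideals_profile B m (Suc a) = x * u / v"
    unfolding ideals_profile_def x_def u_def v_def B by simp
  have 2: "ideals_profile B m a = y * (real (Suc d) * u) / (real (Suc (m + d)) * v)"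
    unfolding ideals_profile_def y_def u_def v_def B by (simp add: Suc_diff_le)
  show "ideals_sum B m a > 0"
  proof -
    have "ideals_sum B m a = K * ideals_profile B m a" using K(2) assms by simp
    then show ?thesis using K(1) pos unfolding 2 by simp
  qed
  have "ideals_sum B m (Suc a) / ideals_sum B m a = ideals_profile B m (Suc a) / ideals_profile B m a"
    using K assms by simp
  also have "\<dots> = real (m + Suc a) * real (Suc (m + d)) / (real (Suc a) * real (Suc d))"
    unfolding 1 2 x using pos by (simp add: divide_simps del: of_nat_Suc of_nat_add)
  finally show "ideals_sum B m (Suc a) / ideals_sum B m a =
      real (m + Suc a) * real (m + B - a) / (real (Suc a) * real (B - a))"
    unfolding B by simp
qed

subsection \<open>Naruse-Newton coefficients of rectangles\<close>

lemma ydiag_replicate: "ydiag (replicate K b) = {1..K} \<times> {1..b}"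
  unfolding ydiag_def by auto

lemma inner_cells_replicate: "inner_cells (replicate (Suc k) (Suc B)) = {1..k} \<times> {1..B}"
  unfolding inner_cells_def ydiag_replicate by auto

lemma hook_replicate:
  assumes "1 \<le> i" "i \<le> K" "1 \<le> j" "j \<le> b"
  shows "hook (replicate K b) (i, j) = (K - i) + (b - j) + 1"
proof -
  have "{(i', j') \<in> ydiag (replicate K b). (i' = i \<and> j' \<ge> j) \<or> (j' = j \<and> i' \<ge> i)} =
    {i} \<times> {j..b} \<union> {Suc i..K} \<times> {j}"
    unfolding ydiag_replicate using assms by auto
  moreover have "card ({i} \<times> {j..b} \<union> {Suc i..K} \<times> {j}) = (Suc b - j) + (K - i)"
    by (subst card_Un_disjoint) (auto simp: card_cartesian_product)
  ultimately show ?thesis unfolding hook_def using assms by simp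
qed

text \<open>The product over the diagram becomes one over the starting cells: an unmoved cell
  contributes its own weight, or 1 in row 1, and a moved cell that of its diagonal
  successor.\<close>

lemma prod_excite:
  fixes h :: "cell \<Rightarrow> real"
  assumes N: "cell_ideal N" "N \<subseteq> {1..k} \<times> {1..B}"
  shows "(\<Prod>c \<in> {c \<in> excite ({1..k} \<times> {1..B}) N. fst c \<noteq> 1}. h c) =
    (\<Prod>i=1..k. \<Prod>j=1..B. if (i, j) \<in> N then if i = 1 then 1 else h (i, j) else h (Suc i, Suc j))"
proof -
  let ?M = "{1..k} \<times> {1..B}"
  let ?s = "\<lambda>(i, j). (Suc i, Suc j)"
  have fin: "finite N" using N(2) by (rule finite_subset) auto
  have split: "{c \<in> excite ?M N. fst c \<noteq> 1} = {c \<in> N. fst c \<noteq> 1} \<union> ?s ` (?M - N)"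
    unfolding excite_def by auto
  \<comment> \<open>If a target lies in \<open>N\<close>, so does its diagonal predecessor, which
    therefore has not moved.\<close>
  have disj: "{c \<in> N. fst c \<noteq> 1} \<inter> ?s ` (?M - N) = {}"
    using cell_idealD[OF N(1)] by fastforce
  have "(\<Prod>c \<in> {c \<in> excite ?M N. fst c \<noteq> 1}. h c) =
    (\<Prod>c \<in> {c \<in> N. fst c \<noteq> 1}. h c) * (\<Prod>c \<in> ?M - N. h (?s c))"
  proof -
    have "inj_on ?s (?M - N)" by (auto simp: inj_on_def)
    then show ?thesis
      unfolding split using fin
      by (subst prod.union_disjoint[OF _ _ disj]) (simp_all add: prod.reindex comp_def)
  qed
  also have "(\<Prod>c \<in> {c \<in> N. fst c \<noteq> 1}. h c) = (\<Prod>c \<in> N. if fst c = 1 then 1 else h c)"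
    using fin by (intro prod.mono_neutral_cong_left) auto
  also have "(\<Prod>c \<in> N. if fst c = 1 then 1 else h c) * (\<Prod>c \<in> ?M - N. h (?s c)) =
    (\<Prod>c\<in>?M. if c \<in> N then if fst c = 1 then 1 else h c else h (?s c))"
    using N(2) by (subst prod.If_cases) (auto intro!: arg_cong2[where f = "(*)"] prod.cong)
  also have "\<dots> = (\<Prod>i=1..k. \<Prod>j=1..B. if (i, j) \<in> N then if i = 1 then 1 else h (i, j) else h (Suc i, Suc j))"
    unfolding prod.cartesian_product by (intro prod.cong) auto
  finally show ?thesis .
qed

text \<open>The contribution of row 1 of the ideal: 1 for cells that stay, and the hook length in
  row 2 for cells that move.\<close>

definition top_weight :: "nat \<Rightarrow> nat \<Rightarrow> nat \<Rightarrow> real" where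
  "top_weight B m a = (\<Prod>j=1..B. if j \<le> a then 1 else real (m + B + 1 - j))"

lemma prod_hook_excite_add_row:
  assumes N: "N \<in> ideals m a" and "a \<le> B"
  shows "(\<Prod>c \<in> {c \<in> excite ({1..Suc m} \<times> {1..B}) (add_row a N). fst c \<noteq> 1}.
      real (hook (replicate (Suc (Suc m)) (Suc B)) c)) = top_weight B m a * ideal_weight B m N"
proof -
  let ?h = "\<lambda>c. real (hook (replicate (Suc (Suc m)) (Suc B)) c)"
  have 0: "(0, j) \<notin> N" for j using N by (auto simp: ideals_def)
  have "add_row a N \<in> ideals (Suc m) B" using add_row_in_ideals assms by blast
  then have "(\<Prod>c \<in> {c \<in> excite ({1..Suc m} \<times> {1..B}) (add_row a N). fst c \<noteq> 1}. ?h c) =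
    (\<Prod>i=1..Suc m. \<Prod>j=1..B. if (i, j) \<in> add_row a N then if i = 1 then 1 else ?h (i, j)
       else ?h (Suc i, Suc j))"
    by (intro prod_excite) (auto simp: ideals_def)
  \<comment> \<open>After the shift \<open>i = 0\<close> is the first row, and the other rows are
    indexed as in \<open>ideal_weight\<close>.\<close>
  also have "\<dots> = (\<Prod>i=0..m. \<Prod>j=1..B. if (Suc i, j) \<in> add_row a N then
       if i = 0 then 1 else ?h (Suc i, j) else ?h (Suc (Suc i), Suc j))"
    unfolding One_nat_def prod.atLeast_Suc_atMost_Suc_shift comp_def
    by (intro prod.cong refl) simp
  also have "\<dots> = (\<Prod>i=0..m. \<Prod>j=1..B. if (Suc i, j) \<in> add_row a N then
       if i = 0 then 1 else real (m + B + 3 - i - j) else real (m + B + 1 - i - j))"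
    by (intro prod.cong refl) (auto simp: hook_replicate simp del: replicate_Suc)
  also have "\<dots> = top_weight B m a * ideal_weight B m N"
    unfolding top_weight_def ideal_weight_def prod.atLeast_Suc_atMost[OF le0]
    by (intro arg_cong2[where f = "(*)"] prod.cong) (auto simp: in_add_row 0)
  finally show ?thesis .
qed

lemma is_partition_replicate: "b > 0 \<Longrightarrow> is_partition (replicate K b)"
  unfolding is_partition_def sorted_wrt_iff_nth_less by auto

text \<open>Fixing a first row of \<open>a\<close> cells makes \<open>top_weight\<close> a common
  factor and leaves the sum over ideals with \<open>m\<close> rows and \<open>a\<close>
  columns.\<close>

lemma NN_coeff_rectangle:
  assumes lam: "lamI I = replicate (Suc (Suc m)) (Suc B)" and "a \<le> B"
  shows "real (NN_coeff I (sI I - a)) = top_weight B m a * ideals_sum B m a"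
proof -
  have "is_partition (lamI I)" "lamI I \<noteq> []" "a \<le> sI I"
    unfolding lam sI_def using \<open>a \<le> B\<close> is_partition_replicate[of "Suc B"] by (simp_all del: replicate_Suc)
  note eq = NN_coeff_eq_sum_ideals[OF this]
  have set: "{N. cell_ideal N \<and> N \<subseteq> {1..Suc m} \<times> {1..B} \<and> card {c \<in> N. fst c = 1} = a} =
    add_row a ` ideals m a"
    unfolding ideals_with_row_1[OF \<open>a \<le> B\<close>, symmetric] by (auto simp: ideals_def)
  show ?thesis
    unfolding eq lam inner_cells_replicate set of_nat_sum of_nat_prod
    using \<open>a \<le> B\<close>
    by (simp only: sum.reindex inj_on_add_row comp_def prod_hook_excite_add_row ideals_sum_def
        sum_distrib_left cong: sum.cong)
qed

lemma lamI_properties: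
  assumes "descent_set I"
  shows "is_partition (lamI I)" "length (lamI I) \<ge> 2" "lamI I ! 0 = lamI I ! 1"
proof -
  obtain lam where lam: "is_partition lam" "length lam \<ge> 2" "lam ! 0 = lam ! 1"
    "ribbon_corr (outer_cells lam) I"
    using lamI_exists[OF assms] by blast
  with lamI_eqI[OF lam] show "is_partition (lamI I)" "length (lamI I) \<ge> 2" "lamI I ! 0 = lamI I ! 1"
    by auto
qed

lemma rectangle_descent_set:
  "\<exists>I. descent_set I \<and> lamI I = replicate (Suc (Suc m)) (Suc B)"
proof -
  let ?K = "Suc (Suc m)" and ?b = "Suc B"
  \<comment> \<open>The border strip is a hook: along the bottom row to the corner, reached at
    \<open>t = ?b\<close>, then up the last column. The up steps are thus the indices from
    \<open>?b\<close> on.\<close>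
  define c where "c t = (if t \<le> ?b then (?K, t) else (?K + ?b - t, ?b))" for t
  define n where "n = ?b + Suc m"
  have outer: "outer_cells (replicate ?K ?b) = {(i, j). 1 \<le> i \<and> i \<le> ?K \<and> 1 \<le> j \<and> j \<le> ?b \<and> (i = ?K \<or> j = ?b)}"
    unfolding outer_cells_def ydiag_replicate by auto
  have "outer_cells (replicate ?K ?b) = c ` {1..n}"
  proof -
    have "x \<in> c ` {1..n}" if "x \<in> outer_cells (replicate ?K ?b)" for x
    proof -
      obtain i j where x: "x = (i, j)" "1 \<le> i" "i \<le> ?K" "1 \<le> j" "j \<le> ?b" "i = ?K \<or> j = ?b"
        using \<open>x \<in> _\<close> unfolding outer by blast
      show ?thesis
      proof (cases "i = ?K")
        case True
        then show ?thesis using x by (intro image_eqI[of _ _ j]) (auto simp: c_def n_def)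
      next
        case False
        then show ?thesis using x by (intro image_eqI[of _ _ "?K + ?b - i"]) (auto simp: c_def n_def)
      qed
    qed
    moreover have "c t \<in> outer_cells (replicate ?K ?b)" if "t \<in> {1..n}" for t
      using that unfolding outer c_def n_def by auto
    ultimately show ?thesis by blast
  qed
  moreover have "if k \<in> {?b..<n} then c k = (fst (c (Suc k)) + 1, snd (c (Suc k)))
      else c (Suc k) = (fst (c k), snd (c k) + 1)" if "k \<in> {1..<n}" for k
    using that unfolding c_def n_def by auto
  ultimately have "ribbon_path c n {?b..<n} (outer_cells (replicate ?K ?b))"
    unfolding ribbon_path_def by (auto simp: n_def)
  then have "ribbon_corr (outer_cells (replicate ?K ?b)) {?b..<n}"
    using ribbon_corr_iff_ribbon_path by blast
  then have "lamI {?b..<n} = replicate ?K ?b"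
    using is_partition_replicate[of ?b ?K] by (intro lamI_eqI) (auto simp del: replicate_Suc)
  moreover have "descent_set {?b..<n}" unfolding descent_set_def n_def by auto
  ultimately show ?thesis by blast
qed

section \<open>Quotients of consecutive coefficients\<close>

lemma top_weight_Suc:
  assumes "Suc a \<le> B"
  shows "top_weight B m a = real (m + B - a) * top_weight B m (Suc a)"
proof -
  have ins: "{1..B} = insert (Suc a) ({1..B} - {Suc a})" using assms by auto
  define P where "P = (\<Prod>j\<in>{1..B} - {Suc a}. if j \<le> a then 1 else real (m + B + 1 - j))"
  have "top_weight B m a = real (m + B + 1 - Suc a) * P"
    unfolding top_weight_def P_def by (subst ins, subst prod.insert) auto
  moreover have "P = (\<Prod>j\<in>{1..B} - {Suc a}. if j \<le> Suc a then 1 else real (m + B + 1 - j))"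
    unfolding P_def by (intro prod.cong) auto
  then have "top_weight B m (Suc a) = P"
    unfolding top_weight_def by (subst ins, subst prod.insert) auto
  ultimately show ?thesis by simp
qed

text \<open>The factor \<open>m + B - a\<close> lost in \<open>top_weight\<close> cancels the same
  factor in the quotient of the sums over ideals.\<close>

lemma rectangle_ratio_in_T_set:
  assumes "Suc a \<le> B"
  shows "real (m + Suc a) / (real (Suc a) * real (B - a)) \<in> T_set a"
proof -
  obtain I where I: "descent_set I" "lamI I = replicate (Suc (Suc m)) (Suc B)"
    using rectangle_descent_set by blast
  have s: "sI I = B" using I(2) by (simp add: sI_def)
  have top: "top_weight B m (Suc a) > 0"
    unfolding top_weight_def by (intro prod_pos) auto
  have "real (NN_coeff I (sI I - a - 1)) / real (NN_coeff I (sI I - a)) =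
    (top_weight B m (Suc a) * ideals_sum B m (Suc a)) / (top_weight B m a * ideals_sum B m a)"
    using NN_coeff_rectangle[OF I(2), of "Suc a"] NN_coeff_rectangle[OF I(2), of a] assms by simp
  also have "\<dots> = (ideals_sum B m (Suc a) / ideals_sum B m a) / real (m + B - a)"
    using top by (simp add: top_weight_Suc[OF assms])
  also have "\<dots> = real (m + Suc a) / (real (Suc a) * real (B - a))"
    unfolding ideals_sum_ratio(2)[OF assms] using assms by simp
  finally show ?thesis
    unfolding T_set_def using I(1) s assms by force
qed

text \<open>Already the rectangles realise \<open>p / q\<close>: take \<open>(a + 1) p - a + 1\<close> rows and \<open>a + q + 1\<close> columns.\<close>

lemma pos_rat_in_T_set:
  assumes "x \<in> \<rat>" "x > 0"
  shows "x \<in> T_set a"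
proof -
  obtain p q where x: "x = real p / real q" "q \<noteq> 0"
    using Rats_abs_nat_div_natE[OF assms(1)] assms(2) by (metis abs_of_pos)
  have "p > 0" using assms(2) x by (cases p) auto
  define m where "m = Suc a * p - Suc a"
  have m: "m + Suc a = Suc a * p" using \<open>p > 0\<close> unfolding m_def by (cases p) auto
  have "real (m + Suc a) / (real (Suc a) * real (a + q - a)) \<in> T_set a"
    using x(2) by (intro rectangle_ratio_in_T_set) simp
  moreover have "real (m + Suc a) / (real (Suc a) * real (a + q - a)) = x"
    unfolding m x(1) of_nat_mult by (simp del: of_nat_Suc)
  ultimately show ?thesis by simp
qed

subsection \<open>Positivity and the theorem\<close>

lemma hook_pos:
  assumes "c \<in> ydiag lam"
  shows "hook lam c > 0"
proof -
  have "c \<in> {(i', j') \<in> ydiag lam. (i' = fst c \<and> j' \<ge> snd c) \<or> (j' = snd c \<and> i' \<ge> fst c)}"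
    using assms by auto
  moreover have "finite {(i', j') \<in> ydiag lam. (i' = fst c \<and> j' \<ge> snd c) \<or> (j' = snd c \<and> i' \<ge> fst c)}"
    using finite_ydiag by (rule finite_subset[rotated]) auto
  ultimately show ?thesis unfolding hook_def by (auto simp: card_gt_0_iff)
qed

text \<open>All terms are products of hook lengths of cells inside the diagram, hence positive, so a
  single ideal with \<open>r\<close> cells in row 1 suffices.\<close>

lemma NN_coeff_pos:
  assumes lam: "is_partition (lamI I)" "lamI I \<noteq> []" and r: "r \<le> sI I"
    and N: "cell_ideal N" "N \<subseteq> inner_cells (lamI I)" "card {c \<in> N. fst c = 1} = r"
  shows "NN_coeff I (sI I - r) > 0"
proof -
  let ?M = "inner_cells (lamI I)"
  let ?S = "{N. cell_ideal N \<and> N \<subseteq> ?M \<and> card {c \<in> N. fst c = 1} = r}"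
  have "finite ?M" using inner_cells_subset[OF lam(1)] finite_ydiag finite_subset by blast
  then have "finite ?S" by (intro finite_subset[of ?S "Pow ?M"]) auto
  moreover have "?S \<noteq> {}" using N by blast
  moreover have "(\<Prod>c \<in> {c \<in> excite ?M N. fst c \<noteq> 1}. hook (lamI I) c) > 0" if "N \<in> ?S" for N
  proof (intro prod_pos ballI hook_pos)
    fix c assume "c \<in> {c \<in> excite ?M N. fst c \<noteq> 1}"
    then show "c \<in> ydiag (lamI I)"
      using that inner_cells_subset[OF lam(1)] unfolding excite_def inner_cells_def by auto
  qed
  ultimately show ?thesis
    unfolding NN_coeff_eq_sum_ideals[OF lam r] by (intro sum_pos)
qed

lemma T_set_0_pos:
  assumes "x \<in> T_set 0"
  shows "x \<in> \<rat>" "x > 0"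
proof -
  obtain I where I: "descent_set I" "sI I \<ge> 1"
    and x: "x = real (NN_coeff I (sI I - 1)) / real (NN_coeff I (sI I - 0))"
    using assms unfolding T_set_def by auto
  note lam = lamI_properties[OF I(1)]
  have ne: "lamI I \<noteq> []" using lam(2) by auto
  \<comment> \<open>Row 2 is as long as row 1, which has at least two cells, so
    \<open>(2, 2)\<close> lies in the diagram.\<close>
  have "(1, 1) \<in> inner_cells (lamI I)"
    using lam I(2) unfolding inner_cells_def ydiag_def sI_def by auto
  moreover have "cell_ideal {(1, 1)}" unfolding cell_ideal_def by auto
  moreover have "{c \<in> {(1 :: nat, 1 :: nat)}. fst c = 1} = {(1, 1)}" by auto
  ultimately have "NN_coeff I (sI I - 1) > 0"
    using I(2) by (intro NN_coeff_pos[OF lam(1) ne, of 1 "{(1, 1)}"]) auto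
  moreover have "NN_coeff I (sI I - 0) > 0"
    by (intro NN_coeff_pos[OF lam(1) ne, of 0 "{}"]) (auto simp: cell_ideal_def)
  ultimately show "x > 0" unfolding x by simp
  show "x \<in> \<rat>" unfolding x by simp
qed

theorem theorem5p3:
  shows "(\<forall>a::nat. closure (T_set a) = {x::real. x \<ge> 0}) \<and>
         T_set 0 = {x::real. x \<in> \<rat> \<and> x > 0}"
proof (intro conjI allI)
  show "T_set 0 = {x::real. x \<in> \<rat> \<and> x > 0}"
    using T_set_0_pos pos_rat_in_T_set by blast
  fix a :: nat
  show "closure (T_set a) = {x::real. x \<ge> 0}"
  proof
    have "T_set a \<subseteq> {x. x \<ge> 0}" unfolding T_set_def by auto
    moreover have "closed {x :: real. x \<ge> 0}" by (simp add: closed_Collect_le)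
    ultimately show "closure (T_set a) \<subseteq> {x. x \<ge> 0}" by (rule closure_minimal)
    show "{x. x \<ge> 0} \<subseteq> closure (T_set a)"
    proof
      fix x :: real assume "x \<in> {x. x \<ge> 0}"
      then have x: "x \<ge> 0" by simp
      show "x \<in> closure (T_set a)"
        unfolding closure_approachable
      proof (intro allI impI)
        fix e :: real assume "e > 0"
        \<comment> \<open>Approximating from above keeps \<open>q\<close> positive even for
          \<open>x = 0\<close>.\<close>
        then obtain q where q: "q \<in> \<rat>" "x < q" "q < x + e"
          using Rats_dense_in_real[of x "x + e"] by auto
        then show "\<exists>y\<in>T_set a. dist y x < e"
          using x pos_rat_in_T_set[of q a] by (intro bexI[of _ q]) (auto simp: dist_real_def)
      qed
    qed
  qed
qed

end
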